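(* Let $r\ge 1$ and $T=2^r+1$, let $E$ be a finite set, let $h_s:E\times E\to\mathbb{R}$ for $s=1,\dots,T-1$, and let $Z(T)=(Z_1,\dots,Z_T)$ have the probability distribution $\pi$ on $E^T$ given by $$\pi(z_1,\dots,z_T)=C^{-1}\exp\sum_{s=1}^{T-1}h_s(z_s,z_{s+1}),$$ where $C$ is the normalizing constant. Thus $Z(T)$ is a bilateral Markov random field with respect to the 2-nearest neighbours system and also a Markov chain. Let $P$ be the transition matrix of this chain (a single matrix for all times), so that the field and the chain are linked by $$\pi(z_t\mid z_{t-1},z_{t+1})=\frac{\pi(z_{t+1}\mid z_t)\,\pi(z_t\mid z_{t-1})}{\sum_{u\in E}\pi(z_{t+1}\mid u)\,\pi(u\mid z_{t-1})},$$ and assume that this link between the Markov field parameters and the entries of the transition matrix can be found explicitly. With $d_j$, $S_j$ and $\pi_j$ as in the context, for each $1\le j\le r+1$ the process $(Z_s)_{s\in S_j}$ is a Markov chain with transition matrix $P^{d_j}$; for $j\ge 2$ it is also a bilateral Markov random field with distribution $\pi_j$, whose conditional distributions $\pi_j(z_s\mid z_{s-d_j},z_{s+d_j})$ are linked to $P^{d_j}$ by the analogous equation. Moreover, $$\pi(z_1,z_2,\dots,z_T)=\prod_{s\in S_{r+1}\setminus S_r}\pi(z_s\mid z_{s-d_{r+1}},z_{s+d_{r+1}})\times\prod_{s\in S_r\setminus S_{r-1}}\pi_r(z_s\mid z_{s-d_r},z_{s+d_r})\times\cdots\times\prod_{s\in S_2\setminus S_1}\pi_2(z_s\mid z_{s-d_2},z_{s+d_2})\times\pi_1(z_1,z_T),$$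 that is, the product over $j=r+1,r,\dots,2$ of $\prod_{s\in S_j\setminus S_{j-1}}\pi_j(z_s\mid z_{s-d_j},z_{s+d_j})$, multiplied by $\pi_1(z_1,z_T)$.
   Context: For $1\le j\le r+1$, $d_j=2^{r+1-j}$ and $S_j=\{1+k\,d_j:0\le k\le 2^{j-1}\}$, so $S_{r+1}=\{1,2,\dots,T\}$, $S_r=\{1,3,5,\dots,T\}$, $S_{r-1}=\{1,5,9,\dots,T\}$, ..., $S_1=\{1,T\}$. $\pi_j$ is the distribution of $(Z_s)_{s\in S_j}$, i.e. the marginal of $\pi$ on the coordinates in $S_j$, with $\pi_{r+1}=\pi$. For $s\in S_j\setminus S_{j-1}$ ($j\ge 2$), $s-d_j$ and $s+d_j$ are the two nearest neighbours of $s$ in $S_j$, and $\pi_j(z_s\mid z_{s-d_j},z_{s+d_j})$ is the conditional probability under $\pi_j$ that $Z_s=z_s$ given $Z_{s-d_j}=z_{s-d_j}$ and $Z_{s+d_j}=z_{s+d_j}$. The notation $\pi(z_t\mid z_{t-1})$ denotes the one-step transition probability of the chain, given by the entries of $P$. *)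

theory Defs
  imports "HOL-Probability.Probability"
begin

text \<open>The state space \<open>E\<close> is a finite type. A configuration in \<open>E^A\<close> is an
  element of \<open>\<Pi>\<^sub>E s\<in>A. UNIV\<close>, that is, a function \<open>nat \<Rightarrow> 'e\<close> which is
  \<open>undefined\<close> outside \<open>A\<close>.\<close>

definition gibbs_weight :: "(nat \<Rightarrow> 'e \<Rightarrow> 'e \<Rightarrow> real) \<Rightarrow> nat \<Rightarrow> (nat \<Rightarrow> 'e) \<Rightarrow> real" where
  "gibbs_weight h T z = exp (\<Sum>s = 1..T - 1. h s (z s) (z (s + 1)))"

definition gibbs_const :: "(nat \<Rightarrow> 'e::finite \<Rightarrow> 'e \<Rightarrow> real) \<Rightarrow> nat \<Rightarrow> real" where
  "gibbs_const h T = (\<Sum>z\<in>(\<Pi>\<^sub>E s\<in>{1..T}. UNIV). gibbs_weight h T z)"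

definition law :: "'w measure \<Rightarrow> (nat \<Rightarrow> 'w \<Rightarrow> 'e) \<Rightarrow> nat set \<Rightarrow> (nat \<Rightarrow> 'e) measure" where
  "law M Z A = distr M (\<Pi>\<^sub>M s\<in>A. count_space UNIV) (\<lambda>\<omega>. \<lambda>s\<in>A. Z s \<omega>)"

text \<open>Meant for \<open>1 \<le> j \<le> r + 1\<close>, where the subtractions do not truncate.\<close>

definition gap :: "nat \<Rightarrow> nat \<Rightarrow> nat" where
  "gap r j = 2 ^ (r + 1 - j)"

definition sites :: "nat \<Rightarrow> nat \<Rightarrow> nat set" where
  "sites r j = (\<lambda>k. 1 + k * gap r j) ` {0..2 ^ (j - 1)}"

lemma sites_finest: "sites r (r + 1) = {1..2 ^ r + 1}"
proof -
  have "sites r (r + 1) = Suc ` {0..2 ^ r}"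
    by (simp add: sites_def gap_def)
  also have "\<dots> = {1..2 ^ r + 1}"
    by simp
  finally show ?thesis .
qed

lemma sites_coarsest: "sites r 1 = {1, 2 ^ r + 1}"
proof -
  have "{0..1::nat} = {0, 1}" by auto
  then show ?thesis by (simp add: sites_def gap_def)
qed

definition consecutive :: "nat set \<Rightarrow> nat \<Rightarrow> nat \<Rightarrow> bool" where
  "consecutive A s t \<longleftrightarrow> s \<in> A \<and> t \<in> A \<and> s < t \<and> {s<..<t} \<inter> A = {}"

text \<open>An interior site has two nearest neighbours, an end point of \<open>A\<close> only one.\<close>

definition nearest_nbrs :: "nat set \<Rightarrow> nat \<Rightarrow> nat set" where
  "nearest_nbrs A s = {u. consecutive A u s \<or> consecutive A s u}"

fun mat_power :: "real^'e^'e \<Rightarrow> nat \<Rightarrow> real^'e^('e::finite)" where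
  "mat_power Q 0 = mat 1"
| "mat_power Q (Suc n) = Q ** mat_power Q n"

definition stochastic_matrix :: "real^'e^('e::finite) \<Rightarrow> bool" where
  "stochastic_matrix Q \<longleftrightarrow> (\<forall>v w. 0 \<le> Q $ v $ w) \<and> (\<forall>v. (\<Sum>w\<in>UNIV. Q $ v $ w) = 1)"

text \<open>The time set is \<open>A\<close> in increasing order, with the same transition matrix \<open>Q\<close> for
  every step from an element of \<open>A\<close> to the next one. Conditional probabilities are
  constrained only when the conditioning event has positive probability, since
  \<^const>\<open>cond_prob\<close> is \<open>0\<close> otherwise.\<close>

definition markov_chain ::
  "'w measure \<Rightarrow> (nat \<Rightarrow> 'w \<Rightarrow> 'e::finite) \<Rightarrow> nat set \<Rightarrow> real^'e^'e \<Rightarrow> bool" where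
  "markov_chain M Z A Q \<longleftrightarrow> stochastic_matrix Q \<and>
    (\<forall>s t z. consecutive A s t \<longrightarrow> \<P>(\<omega> in M. \<forall>u\<in>A. u \<le> s \<longrightarrow> Z u \<omega> = z u) > 0 \<longrightarrow>
      \<P>(\<omega> in M. Z t \<omega> = z t \<bar> \<forall>u\<in>A. u \<le> s \<longrightarrow> Z u \<omega> = z u) = Q $ z s $ z t)"

definition nn_markov_field ::
  "'w measure \<Rightarrow> (nat \<Rightarrow> 'w \<Rightarrow> 'e) \<Rightarrow> nat set \<Rightarrow> bool" where
  "nn_markov_field M Z A \<longleftrightarrow>
    (\<forall>s\<in>A. \<forall>z. \<P>(\<omega> in M. \<forall>u\<in>A - {s}. Z u \<omega> = z u) > 0 \<longrightarrow>
      \<P>(\<omega> in M. Z s \<omega> = z s \<bar> \<forall>u\<in>A - {s}. Z u \<omega> = z u) =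
      \<P>(\<omega> in M. Z s \<omega> = z s \<bar> \<forall>u\<in>nearest_nbrs A s. Z u \<omega> = z u))"

text \<open>The two-sided conditional probability, under a distribution \<open>\<mu>\<close> on configurations, of
  the value at \<open>s\<close> given the values at \<open>s - d\<close> and \<open>s + d\<close>; meant for \<open>d < s\<close>.\<close>

definition bilateral_cond ::
  "(nat \<Rightarrow> 'e) measure \<Rightarrow> nat \<Rightarrow> nat \<Rightarrow> (nat \<Rightarrow> 'e) \<Rightarrow> real" where
  "bilateral_cond \<mu> d s z =
    \<P>(x in \<mu>. x s = z s \<bar> x (s - d) = z (s - d) \<and> x (s + d) = z (s + d))"

end

theory Submission
  imports Defs
begin

text \<open>
  Everything is expressed through the cylinder probabilities \<open>cyl A z\<close>, the probability
  that \<open>Z\<close> agrees with \<open>z\<close> on the set of times \<open>A\<close>.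

  Summing the Gibbs distribution over its last coordinates, one at a time, leaves the Gibbs
  weight of the remaining initial segment times a positive function of its last value
  (\<open>gibbs_prefix\<close>). Hence the ratio of two successive cylinder probabilities depends only on
  the last two values, and since every cylinder has positive probability this ratio must be
  the entry of \<open>P\<close>: a Gibbs distribution is a positive homogeneous chain
  (\<open>positive_chain_of_gibbs\<close>).

  For such a chain, any sites of the past other than the present may be forgotten, and
  intermediate steps may be summed out. So appending to an arbitrary set of times ending in \<open>t\<close>
  a further time \<open>t + n\<close> multiplies the cylinder probability by an entry of \<open>P\<close> to the power
  \<open>n\<close> (\<open>cyl_jump\<close>). This gives the Markov chain on every equally spaced subset. It also gives
  the conditional independence of past and future given the present, from which, on both
  sides, the effect of adding one site to an arbitrary set of times depends only on the
  nearest sites (\<open>local_ratio\<close>); this is the Markov field property on every set of times.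

  The product formula telescopes over \<open>j\<close>. Going from \<open>sites r (j - 1)\<close> to \<open>sites r j\<close>, each new
  site lies midway between two old ones, so it contributes exactly its bilateral conditional
  probability, whatever other new sites have been added before (\<open>refine_sites\<close>).
\<close>

section \<open>Cylinder probabilities of a finite-state process\<close>

locale finite_process = prob_space M
  for M :: "'w measure" +
  fixes Z :: "nat \<Rightarrow> 'w \<Rightarrow> 'e::finite"
    and T :: nat
  assumes Z_measurable: "\<And>t. t \<in> {1..T} \<Longrightarrow> Z t \<in> measurable M (count_space UNIV)"
begin

definition cyl :: "nat set \<Rightarrow> (nat \<Rightarrow> 'e) \<Rightarrow> real" where
  "cyl A z = \<P>(\<omega> in M. \<forall>u\<in>A. Z u \<omega> = z u)"

lemma cyl_cong: "(\<And>u. u \<in> A \<Longrightarrow> z u = z' u) \<Longrightarrow> cyl A z = cyl A z'"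
  by (simp add: cyl_def cong: ball_cong)

lemma cyl_event:
  assumes "A \<subseteq> {1..T}"
  shows "{\<omega> \<in> space M. \<forall>u\<in>A. Z u \<omega> = z u} \<in> events"
proof (rule sets.sets_Collect_finite_All)
  show "finite A" using assms finite_subset by blast
next
  fix u assume "u \<in> A"
  then have "Z u \<in> measurable M (count_space UNIV)"
    using assms Z_measurable by blast
  then have "Z u -` {z u} \<inter> space M \<in> events"
    by (rule measurable_sets) simp
  moreover have "Z u -` {z u} \<inter> space M = {\<omega> \<in> space M. Z u \<omega> = z u}" by auto
  ultimately show "{\<omega> \<in> space M. Z u \<omega> = z u} \<in> events" by simp
qed

lemma cyl_marginal:
  assumes "A \<subseteq> {1..T}" "s \<in> {1..T}" "s \<notin> A"
  shows "cyl A z = (\<Sum>u\<in>UNIV. cyl (insert s A) (z(s := u)))"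
proof -
  let ?E = "\<lambda>u. {\<omega> \<in> space M. \<forall>v\<in>insert s A. Z v \<omega> = (z(s := u)) v}"
  have E: "?E u = {\<omega> \<in> space M. Z s \<omega> = u \<and> (\<forall>v\<in>A. Z v \<omega> = z v)}" for u
  proof -
    have "(\<forall>v\<in>A. Z v \<omega> = (z(s := u)) v) \<longleftrightarrow> (\<forall>v\<in>A. Z v \<omega> = z v)" for \<omega>
      using assms(3) by (intro ball_cong) auto
    then show ?thesis by simp
  qed
  have "prob (\<Union>u\<in>UNIV. ?E u) = (\<Sum>u\<in>UNIV. prob (?E u))"
  proof (rule finite_measure_finite_Union)
    show "range ?E \<subseteq> events"
      using cyl_event[of "insert s A"] assms(1,2) by blast
    show "disjoint_family_on ?E UNIV"
      unfolding E by (simp add: disjoint_family_on_def disjoint_iff)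
  qed simp
  moreover have "(\<Union>u\<in>UNIV. ?E u) = {\<omega> \<in> space M. \<forall>v\<in>A. Z v \<omega> = z v}"
    unfolding E by blast
  ultimately show ?thesis by (simp only: cyl_def)
qed

text \<open>Conditional probabilities enter the theorem in many syntactic forms; the hypotheses only ask
  that the two events be cylinders through a common configuration.\<close>

lemma cond_prob_cyl:
  assumes "\<And>\<omega>. Q \<omega> \<longleftrightarrow> (\<forall>u\<in>B. Z u \<omega> = z u)"
    and "\<And>\<omega>. R \<omega> \<and> Q \<omega> \<longleftrightarrow> (\<forall>u\<in>C. Z u \<omega> = z u)"
  shows "\<P>(\<omega> in M. R \<omega> \<bar> Q \<omega>) = cyl C z / cyl B z"
proof -
  have "{\<omega> \<in> space M. R \<omega> \<and> Q \<omega>} = {\<omega> \<in> space M. \<forall>u\<in>C. Z u \<omega> = z u}"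
    using assms(2) by blast
  moreover have "{\<omega> \<in> space M. Q \<omega>} = {\<omega> \<in> space M. \<forall>u\<in>B. Z u \<omega> = z u}"
    using assms(1) by blast
  ultimately show ?thesis by (simp only: cond_prob_def cyl_def)
qed

lemma prob_law:
  assumes "A \<subseteq> {1..T}" "B \<subseteq> A" "\<And>x. Q x \<longleftrightarrow> (\<forall>u\<in>B. x u = z u)"
  shows "\<P>(x in law M Z A. Q x) = cyl B z"
proof -
  let ?N = "\<Pi>\<^sub>M s\<in>A. count_space (UNIV :: 'e set)"
  let ?f = "\<lambda>\<omega>. \<lambda>s\<in>A. Z s \<omega>"
  have finB: "finite B" by (rule finite_subset[OF subset_trans[OF assms(2,1)]]) simp
  have meas: "?f \<in> measurable M ?N"
    using assms(1) Z_measurable by (intro measurable_restrict) blast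
  have "{x \<in> space ?N. \<forall>u\<in>B. x u = z u} \<in> sets ?N"
  proof (rule sets.sets_Collect_finite_All[OF _ finB])
    fix u assume "u \<in> B"
    then have "(\<lambda>x. x u) \<in> measurable ?N (count_space UNIV)"
      using assms(2) by (intro measurable_component_singleton) blast
    then have "(\<lambda>x. x u) -` {z u} \<inter> space ?N \<in> sets ?N"
      by (rule measurable_sets) simp
    moreover have "(\<lambda>x. x u) -` {z u} \<inter> space ?N = {x \<in> space ?N. x u = z u}" by auto
    ultimately show "{x \<in> space ?N. x u = z u} \<in> sets ?N" by simp
  qed
  then have "\<P>(x in law M Z A. Q x) = prob (?f -` {x \<in> space ?N. \<forall>u\<in>B. x u = z u} \<inter> space M)"
    unfolding law_def assms(3) space_distr by (rule measure_distr[OF meas])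
  also have "?f -` {x \<in> space ?N. \<forall>u\<in>B. x u = z u} \<inter> space M
      = {\<omega> \<in> space M. \<forall>u\<in>B. Z u \<omega> = z u}"
    using assms(2) by (auto simp: space_PiM subset_iff)
  finally show ?thesis by (simp add: cyl_def)
qed

lemma cond_prob_law:
  assumes "A \<subseteq> {1..T}" "B \<subseteq> A" "C \<subseteq> A"
    and "\<And>x. Q x \<longleftrightarrow> (\<forall>u\<in>B. x u = z u)"
    and "\<And>x. R x \<and> Q x \<longleftrightarrow> (\<forall>u\<in>C. x u = z u)"
  shows "\<P>(x in law M Z A. R x \<bar> Q x) = cyl C z / cyl B z"
  unfolding cond_prob_def
  by (simp only: prob_law[OF assms(1,2,4)] prob_law[OF assms(1,3,5)])

lemma bilateral_cond_cyl:
  assumes "A \<subseteq> {1..T}" "{s - d, s, s + d} \<subseteq> A"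
  shows "bilateral_cond (law M Z A) d s z = cyl {s - d, s, s + d} z / cyl {s - d, s + d} z"
  unfolding bilateral_cond_def using assms by (intro cond_prob_law) auto

text \<open>Both sides are additive in the coordinates of the past that are left free, so a
  factorisation of the transition out of the whole past survives forgetting any part of
  it except the present \<open>t\<close>.\<close>

lemma step_forget_past:
  assumes step: "\<And>z. cyl {1..t + 1} z = cyl {1..t} z * R (z t) (z (t + 1))"
    and "t + 1 \<le> T" "A \<subseteq> {1..t}" "t \<in> A"
  shows "cyl (insert (t + 1) A) z = cyl A z * R (z t) (z (t + 1))"
  using assms(3,4)
proof (induction "card ({1..t} - A)" arbitrary: A z)
  case 0
  then have "A = {1..t}" by auto
  moreover have "insert (t + 1) {1..t} = {1..t + 1}" by auto
  ultimately show ?case using step by metis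
next
  case (Suc n)
  then obtain s where s: "s \<in> {1..t}" "s \<notin> A"
    by (metis Diff_eq_empty_iff card.empty nat.distinct(1) subsetI)
  then have "{1..t} - A = insert s ({1..t} - insert s A)" by auto
  then have card: "n = card ({1..t} - insert s A)"
    using Suc.hyps(2) by (metis DiffE card_insert_disjoint finite_Diff finite_atLeastAtMost
        insertI1 nat.inject)
  have st: "s \<noteq> t" "s \<noteq> t + 1" using s Suc.prems by auto
  have "cyl (insert (t + 1) A) z = (\<Sum>u\<in>UNIV. cyl (insert s (insert (t + 1) A)) (z(s := u)))"
    using Suc.prems s st assms(2) by (intro cyl_marginal) auto
  also have "\<dots> = (\<Sum>u\<in>UNIV. cyl (insert s A) (z(s := u)) * R (z t) (z (t + 1)))"
  proof (rule sum.cong[OF refl])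
    fix u
    show "cyl (insert s (insert (t + 1) A)) (z(s := u))
        = cyl (insert s A) (z(s := u)) * R (z t) (z (t + 1))"
      using Suc.hyps(1)[OF card, of "z(s := u)"] Suc.prems s st
      by (simp add: insert_commute)
  qed
  also have "\<dots> = cyl A z * R (z t) (z (t + 1))"
    using Suc.prems s assms(2) by (subst cyl_marginal[of A s]) (auto simp: sum_distrib_right)
  finally show ?case .
qed

lemma cyl_pos_of_full:
  assumes full: "\<And>z. cyl {1..T} z > 0" and "A \<subseteq> {1..T}"
  shows "cyl A z > 0"
proof -
  have "cyl {1..T} z \<le> cyl A z"
    unfolding cyl_def using assms(2) by (intro finite_measure_mono cyl_event) auto
  then show ?thesis using full[of z] by simp
qed

end


section \<open>Positive homogeneous chains\<close>

lemma stochastic_mat_power: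
  assumes "stochastic_matrix Q"
  shows "stochastic_matrix (mat_power Q n)"
proof (induction n)
  case 0
  show ?case by (auto simp: stochastic_matrix_def mat_def)
next
  case (Suc n)
  have "(\<Sum>w\<in>UNIV. (Q ** mat_power Q n) $ v $ w) = 1" for v
  proof -
    have "(\<Sum>w\<in>UNIV. (Q ** mat_power Q n) $ v $ w)
        = (\<Sum>u\<in>UNIV. \<Sum>w\<in>UNIV. Q $ v $ u * mat_power Q n $ u $ w)"
      unfolding matrix_matrix_mult_def by (simp, rule sum.swap)
    also have "\<dots> = 1"
      using Suc assms by (simp add: stochastic_matrix_def flip: sum_distrib_left)
    finally show ?thesis .
  qed
  moreover have "0 \<le> (Q ** mat_power Q n) $ v $ w" for v w
    using Suc assms by (auto simp: stochastic_matrix_def matrix_matrix_mult_def intro!: sum_nonneg)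
  ultimately show ?case by (simp add: stochastic_matrix_def)
qed

text \<open>One transition must be observed, \<open>1 < T\<close>: it is what forces \<open>P\<close> to be stochastic.\<close>

locale positive_chain = finite_process M Z T
  for M :: "'w measure" and Z :: "nat \<Rightarrow> 'w \<Rightarrow> 'e::finite" and T +
  fixes P :: "real^'e^'e"
  assumes T_gt_1: "1 < T"
    and full_pos: "\<And>z. cyl {1..T} z > 0"
    and step: "\<And>t z. 1 \<le> t \<Longrightarrow> t < T \<Longrightarrow>
      cyl {1..t + 1} z = cyl {1..t} z * P $ z t $ z (t + 1)"
begin

lemma cyl_pos: "A \<subseteq> {1..T} \<Longrightarrow> cyl A z > 0"
  using cyl_pos_of_full full_pos by blast

text \<open>Chapman-Kolmogorov: the intermediate value at \<open>t + 1\<close> is summed out, and the remaining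
  \<open>n\<close> steps start from the enlarged past that includes \<open>t + 1\<close>.\<close>

lemma cyl_jump:
  assumes "A \<subseteq> {1..t}" "t \<in> A" "t + n \<le> T" "0 < n"
  shows "cyl (insert (t + n) A) z = cyl A z * mat_power P n $ z t $ z (t + n)"
  using assms
proof (induction n arbitrary: A t z)
  case (Suc n)
  have one: "cyl (insert (t + 1) A) x = cyl A x * P $ x t $ x (t + 1)" for x
  proof (rule step_forget_past[where R = "\<lambda>v w. P $ v $ w"])
    have "1 \<le> t" "t < T" using Suc.prems by auto
    then show "cyl {1..t + 1} z = cyl {1..t} z * P $ z t $ z (t + 1)" for z by (rule step)
  qed (use Suc.prems in auto)
  show ?case
  proof (cases "n = 0")
    case True
    then show ?thesis using one[of z] by simp
  next
    case False
    have "cyl (insert (t + Suc n) A) z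
        = (\<Sum>u\<in>UNIV. cyl (insert (t + 1) (insert (t + Suc n) A)) (z(t + 1 := u)))"
      using Suc.prems False by (intro cyl_marginal) auto
    also have "\<dots> = (\<Sum>u\<in>UNIV. cyl A z * (P $ z t $ u * mat_power P n $ u $ z (t + Suc n)))"
    proof (rule sum.cong[OF refl])
      fix u
      let ?y = "z(t + 1 := u)"
      have "cyl (insert (t + 1) (insert (t + Suc n) A)) ?y
          = cyl (insert (t + 1 + n) (insert (t + 1) A)) ?y"
        by (simp add: insert_commute)
      also have "\<dots> = cyl (insert (t + 1) A) ?y * mat_power P n $ ?y (t + 1) $ ?y (t + 1 + n)"
        using Suc.prems False by (intro Suc.IH) auto
      also have "\<dots> = cyl A ?y * (P $ z t $ u * mat_power P n $ u $ z (t + Suc n))"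
        using one[of ?y] False by simp
      also have "cyl A ?y = cyl A z"
        using Suc.prems by (intro cyl_cong) auto
      finally show "cyl (insert (t + 1) (insert (t + Suc n) A)) ?y
          = cyl A z * (P $ z t $ u * mat_power P n $ u $ z (t + Suc n))" .
    qed
    also have "\<dots> = cyl A z * mat_power P (Suc n) $ z t $ z (t + Suc n)"
      by (simp add: matrix_matrix_mult_def sum_distrib_left)
    finally show ?thesis .
  qed
qed simp

lemma P_stochastic: "stochastic_matrix P"
proof -
  have two: "cyl {1, 2} z = cyl {1} z * P $ z 1 $ z 2" for z
    using cyl_jump[of "{1}" 1 1 z] T_gt_1 by (simp add: insert_commute numeral_2_eq_2)
  have pos: "0 < cyl {1, 2} z" "0 < cyl {1} z" for z
    using T_gt_1 by (auto intro!: cyl_pos)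
  have "0 \<le> P $ v $ w" for v w
    using two[of "(\<lambda>_. v)(2 := w)"] pos[of "(\<lambda>_. v)(2 := w)"]
    by (simp add: zero_less_mult_iff)
  moreover have "(\<Sum>w\<in>UNIV. P $ v $ w) = 1" for v
  proof -
    let ?z = "\<lambda>_. v"
    have "cyl {1} ?z = (\<Sum>w\<in>UNIV. cyl (insert 2 {1}) (?z(2 := w)))"
      using T_gt_1 by (intro cyl_marginal) auto
    also have "\<dots> = (\<Sum>w\<in>UNIV. cyl {1} ?z * P $ v $ w)"
      using two cyl_cong[of "{1}" "?z(2 := _)" ?z] by (simp add: insert_commute)
    also have "\<dots> = cyl {1} ?z * (\<Sum>w\<in>UNIV. P $ v $ w)"
      by (simp add: sum_distrib_left)
    finally show ?thesis using pos(2)[of ?z] by simp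
  qed
  ultimately show ?thesis by (simp add: stochastic_matrix_def)
qed

lemma chain_on_subset:
  assumes "A \<subseteq> {1..T}" "\<And>s t. consecutive A s t \<Longrightarrow> t = s + d" "0 < d"
  shows "markov_chain M Z A (mat_power P d)"
  unfolding markov_chain_def
proof (intro conjI allI impI)
  show "stochastic_matrix (mat_power P d)"
    by (rule stochastic_mat_power[OF P_stochastic])
next
  fix s t and z :: "nat \<Rightarrow> 'e"
  assume st: "consecutive A s t"
  then have t: "t = s + d" by (rule assms(2))
  let ?B = "A \<inter> {..s}"
  have B: "?B \<subseteq> {1..s}" "s \<in> ?B" "s + d \<le> T"
    using st t assms(1) by (auto simp: consecutive_def)
  have "\<P>(\<omega> in M. Z t \<omega> = z t \<bar> \<forall>u\<in>A. u \<le> s \<longrightarrow> Z u \<omega> = z u) = cyl (insert t ?B) z / cyl ?B z"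
    by (rule cond_prob_cyl) auto
  also have "\<dots> = mat_power P d $ z s $ z t"
    using cyl_jump[OF B assms(3), of z] cyl_pos[of ?B z] assms(1) t by force
  finally show "\<P>(\<omega> in M. Z t \<omega> = z t \<bar> \<forall>u\<in>A. u \<le> s \<longrightarrow> Z u \<omega> = z u) = mat_power P d $ z s $ z t" .
qed


section \<open>The chain as a nearest-neighbour field\<close>

text \<open>Past and future are conditionally independent given the present. The future \<open>C\<close> is
  built up in increasing order; each new site contributes a factor that depends only
  on the site just before it, which is the same with and without the past \<open>B\<close>.\<close>

lemma past_future:
  assumes "B \<subseteq> {1..t}" "t \<in> B" "C \<subseteq> {t<..T}"
  shows "cyl (B \<union> C) z * cyl {t} z = cyl B z * cyl (insert t C) z"
proof -
  have "finite C" using assms(3) finite_subset by blast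
  then show ?thesis using assms(3)
  proof (induction C rule: finite_linorder_max_induct)
    case empty
    show ?case by simp
  next
    case (insert m C)
    define p where "p = Max (insert t C)"
    have p: "p \<in> insert t C" "\<And>u. u \<in> insert t C \<Longrightarrow> u \<le> p"
      using insert.hyps(1) Max_in[of "insert t C"] unfolding p_def by auto
    then have m: "p < m" "m \<le> T" using insert by auto
    then have m': "p + (m - p) = m" by simp
    have jump: "cyl (insert m A) z = cyl A z * mat_power P (m - p) $ z p $ z m"
      if "A \<subseteq> {1..p}" "p \<in> A" for A
      using cyl_jump[OF that, of "m - p"] m by (simp add: m')
    have tp: "t \<le> p" "1 \<le> t" using p(2) assms(1,2) by auto
    have "cyl (insert m (B \<union> C)) z = cyl (B \<union> C) z * mat_power P (m - p) $ z p $ z m"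
    proof (rule jump)
      show "p \<in> B \<union> C" using p(1) assms(2) by blast
      show "B \<union> C \<subseteq> {1..p}"
        using assms(1) tp p(2) insert.prems by fastforce
    qed
    moreover have "cyl (insert m (insert t C)) z
        = cyl (insert t C) z * mat_power P (m - p) $ z p $ z m"
      by (rule jump) (use p tp insert.prems in fastforce)+
    moreover have "cyl (B \<union> C) z * cyl {t} z = cyl B z * cyl (insert t C) z"
      using insert by blast
    ultimately show ?case by (simp add: insert_commute algebra_simps)
  qed
qed

lemma cross_ratio:
  fixes q :: real
  assumes "x * q = l * y" "x' * q = l * y'" "q \<noteq> 0"
  shows "x * y' = x' * y"
proof -
  have "(x * y') * q = (x' * y) * q" using assms(1,2) by algebra
  then show ?thesis using assms(3) by simp
qed

text \<open>With \<open>L'\<close> the last site of \<open>L\<close> (or nothing), ratios of cylinder probabilities do not see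
  the rest of \<open>L\<close>.\<close>

lemma forget_left:
  assumes L: "L \<subseteq> {1..<s}" and C: "C \<subseteq> {s..T}" "C' \<subseteq> {s..T}"
    and L': "L = {} \<and> L' = {} \<or> L \<noteq> {} \<and> L' = {Max L}"
  shows "cyl (L \<union> C) z * cyl (L' \<union> C') z = cyl (L \<union> C') z * cyl (L' \<union> C) z"
proof (cases "L = {}")
  case True
  then show ?thesis using L' by simp
next
  case False
  define a where "a = Max L"
  have fin: "finite L" using L finite_subset by blast
  then have a: "a \<in> L" "L \<subseteq> {1..a}"
    using False L unfolding a_def by (auto simp: Max_in)
  then have "a < s" using L by auto
  then have D: "C \<subseteq> {a<..T}" "C' \<subseteq> {a<..T}" using C by auto
  show ?thesis
  proof (cases "C = {} \<and> C' = {}")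
    case False
    then have "a \<in> {1..T}" using D a L by fastforce
    then have "cyl {a} z > 0" by (intro cyl_pos) auto
    then have "cyl (L \<union> C) z * cyl (insert a C') z = cyl (L \<union> C') z * cyl (insert a C) z"
      by (intro cross_ratio[OF past_future[OF a(2,1) D(1)] past_future[OF a(2,1) D(2)]]) simp
    moreover have "L' = {a}" using L' a by (auto simp: a_def)
    ultimately show ?thesis by simp
  qed simp
qed

lemma forget_right:
  assumes R: "R \<subseteq> {s<..T}" and C: "C \<subseteq> {1..s}" "C' \<subseteq> {1..s}"
    and R': "R = {} \<and> R' = {} \<or> R \<noteq> {} \<and> R' = {Min R}"
  shows "cyl (C \<union> R) z * cyl (C' \<union> R') z = cyl (C' \<union> R) z * cyl (C \<union> R') z"
proof (cases "R = {}")
  case True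
  then show ?thesis using R' by simp
next
  case False
  define b where "b = Min R"
  have fin: "finite R" using R finite_subset by blast
  then have b: "b \<in> R" "\<And>u. u \<in> R \<Longrightarrow> b \<le> u"
    using False unfolding b_def by auto
  then have b': "s < b" "b \<le> T" using R by auto
  have pf: "cyl (A \<union> R) z * cyl {b} z = cyl R z * cyl (A \<union> {b}) z" if "A \<subseteq> {1..s}" for A
  proof -
    have "cyl (insert b A \<union> (R - {b})) z * cyl {b} z
        = cyl (insert b A) z * cyl (insert b (R - {b})) z"
    proof (rule past_future)
      show "insert b A \<subseteq> {1..b}" using that b' by auto
      show "R - {b} \<subseteq> {b<..T}" using b(2) R by (force simp: order_less_le)
    qed simp
    moreover have "insert b A \<union> (R - {b}) = A \<union> R" "insert b (R - {b}) = R"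
      using b(1) by auto
    ultimately show ?thesis by (simp add: mult.commute)
  qed
  have "cyl {b} z > 0" using b' by (intro cyl_pos) auto
  then have "cyl (C \<union> R) z * cyl (C' \<union> {b}) z = cyl (C' \<union> R) z * cyl (C \<union> {b}) z"
    by (intro cross_ratio[OF pf[OF C(1)] pf[OF C(2)]]) simp
  moreover have "R' = {b}" using R' False by (simp add: b_def)
  ultimately show ?thesis by simp
qed

text \<open>First the far part of \<open>L\<close> is dropped while all of \<open>R\<close> is kept, then the far part of \<open>R\<close>.
  Empty sides are admitted so that end points are treated like interior sites.\<close>

lemma local_ratio:
  assumes L: "L \<subseteq> {1..<s}" and R: "R \<subseteq> {s<..T}" and s: "s \<in> {1..T}"
    and L': "L = {} \<and> L' = {} \<or> L \<noteq> {} \<and> L' = {Max L}"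
    and R': "R = {} \<and> R' = {} \<or> R \<noteq> {} \<and> R' = {Min R}"
  shows "cyl (insert s (L \<union> R)) z / cyl (L \<union> R) z
       = cyl (insert s (L' \<union> R')) z / cyl (L' \<union> R') z"
proof -
  have subL: "L' \<subseteq> L" using L' Max_in[OF finite_subset[OF L]] by auto
  have subR: "R' \<subseteq> R" using R' Min_in[OF finite_subset[OF R]] by auto
  have pos: "cyl (L \<union> R) z > 0" "cyl (L' \<union> R) z > 0" "cyl (L' \<union> R') z > 0"
    using L R s subL subR by (auto intro!: cyl_pos)
  have "cyl (L \<union> insert s R) z * cyl (L' \<union> R) z = cyl (L \<union> R) z * cyl (L' \<union> insert s R) z"
    using R s by (intro forget_left[OF L _ _ L']) auto
  then have 1: "cyl (insert s (L \<union> R)) z / cyl (L \<union> R) z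
      = cyl (insert s (L' \<union> R)) z / cyl (L' \<union> R) z"
    using pos by (simp add: field_simps)
  have "cyl (insert s L' \<union> R) z * cyl (L' \<union> R') z = cyl (L' \<union> R) z * cyl (insert s L' \<union> R') z"
    using L s subL by (intro forget_right[OF R _ _ R']) auto
  then have "cyl (insert s (L' \<union> R)) z / cyl (L' \<union> R) z
      = cyl (insert s (L' \<union> R')) z / cyl (L' \<union> R') z"
    using pos by (simp add: field_simps)
  with 1 show ?thesis by simp
qed

lemma field_on_subset:
  assumes A: "A \<subseteq> {1..T}"
  shows "nn_markov_field M Z A"
  unfolding nn_markov_field_def
proof (intro ballI allI impI)
  fix s and z :: "nat \<Rightarrow> 'e"
  assume s: "s \<in> A"
  define L where "L = A \<inter> {..<s}"
  define R where "R = A \<inter> {s<..}"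
  define L' where "L' = {u. consecutive A u s}"
  define R' where "R' = {u. consecutive A s u}"
  have finA: "finite A" using A finite_subset by blast
  have LR: "A - {s} = L \<union> R" by (auto simp: L_def R_def)
  have nbrs: "nearest_nbrs A s = L' \<union> R'"
    by (auto simp: nearest_nbrs_def L'_def R'_def)
  have L': "L = {} \<and> L' = {} \<or> L \<noteq> {} \<and> L' = {Max L}"
  proof (cases "L = {}")
    case False
    have "consecutive A u s \<longleftrightarrow> u = Max L" for u
    proof -
      have "u = Max L \<longleftrightarrow> u \<in> L \<and> (\<forall>v\<in>L. v \<le> u)"
        using False finA eq_Max_iff[of L u] by (auto simp: L_def)
      moreover have "consecutive A u s \<longleftrightarrow> u \<in> L \<and> (\<forall>v\<in>L. v \<le> u)"
        using s by (auto simp: consecutive_def L_def disjoint_iff Ball_def simp flip: not_le)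
      ultimately show ?thesis by simp
    qed
    then show ?thesis using False by (auto simp: L'_def)
  qed (auto simp: L_def L'_def consecutive_def)
  have R': "R = {} \<and> R' = {} \<or> R \<noteq> {} \<and> R' = {Min R}"
  proof (cases "R = {}")
    case False
    have "consecutive A s u \<longleftrightarrow> u = Min R" for u
    proof -
      have "u = Min R \<longleftrightarrow> u \<in> R \<and> (\<forall>v\<in>R. u \<le> v)"
        using False finA eq_Min_iff[of R u] by (auto simp: R_def)
      moreover have "consecutive A s u \<longleftrightarrow> u \<in> R \<and> (\<forall>v\<in>R. u \<le> v)"
        using s by (auto simp: consecutive_def R_def disjoint_iff Ball_def simp flip: not_le)
      ultimately show ?thesis by simp
    qed
    then show ?thesis using False by (auto simp: R'_def)
  qed (auto simp: R_def R'_def consecutive_def)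
  have "\<P>(\<omega> in M. Z s \<omega> = z s \<bar> \<forall>u\<in>A - {s}. Z u \<omega> = z u)
      = cyl (insert s (L \<union> R)) z / cyl (L \<union> R) z"
    by (rule cond_prob_cyl) (auto simp: LR)
  also have "\<dots> = cyl (insert s (L' \<union> R')) z / cyl (L' \<union> R') z"
    using A s by (intro local_ratio L' R') (auto simp: L_def R_def)
  also have "\<dots> = \<P>(\<omega> in M. Z s \<omega> = z s \<bar> \<forall>u\<in>nearest_nbrs A s. Z u \<omega> = z u)"
    by (rule cond_prob_cyl[symmetric]) (auto simp: nbrs)
  finally show "\<P>(\<omega> in M. Z s \<omega> = z s \<bar> \<forall>u\<in>A - {s}. Z u \<omega> = z u)
      = \<P>(\<omega> in M. Z s \<omega> = z s \<bar> \<forall>u\<in>nearest_nbrs A s. Z u \<omega> = z u)" .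
qed

lemma cyl_insert_between:
  assumes A: "A \<subseteq> {1..T}" and ab: "a \<in> A" "b \<in> A" "a < s" "s < b" "A \<inter> {a<..<b} = {}"
  shows "cyl (insert s A) z = cyl {a, s, b} z / cyl {a, b} z * cyl A z"
proof -
  define L where "L = A \<inter> {..<s}"
  define R where "R = A \<inter> {s<..}"
  have finA: "finite A" using A finite_subset by blast
  have "s \<notin> A" using ab by auto
  then have LR: "A = L \<union> R" unfolding L_def R_def using nat_neq_iff by blast
  have outside: "v \<le> a \<or> b \<le> v" if "v \<in> A" for v
    using that ab(5) by (meson disjoint_iff greaterThanLessThan_iff not_le)
  have "Max L = a"
    using finA ab outside by (intro Max_eqI) (fastforce simp: L_def)+
  moreover have "Min R = b"
    using finA ab outside by (intro Min_eqI) (fastforce simp: R_def)+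
  moreover have "L \<noteq> {}" "R \<noteq> {}" using ab by (auto simp: L_def R_def)
  ultimately have "cyl (insert s (L \<union> R)) z / cyl (L \<union> R) z
      = cyl (insert s ({a} \<union> {b})) z / cyl ({a} \<union> {b}) z"
    using A ab by (intro local_ratio) (auto simp: L_def R_def)
  moreover have "cyl A z > 0" using A by (rule cyl_pos)
  ultimately show ?thesis
    unfolding LR[symmetric] by (simp add: insert_commute field_simps)
qed

text \<open>Numerator and denominator share the factor \<open>cyl {s - d} z\<close>, which cancels: no marginal
  distribution enters the link.\<close>

lemma bilateral_link:
  assumes "1 \<le> d" "d < s" "s + d \<le> T"
  shows "cyl {s - d, s, s + d} z / cyl {s - d, s + d} z
    = mat_power P d $ z s $ z (s + d) * mat_power P d $ z (s - d) $ z s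
      / (\<Sum>u\<in>UNIV. mat_power P d $ u $ z (s + d) * mat_power P d $ z (s - d) $ u)"
proof -
  have three: "cyl {s - d, s, s + d} x = cyl {s - d} x *
      (mat_power P d $ x s $ x (s + d) * mat_power P d $ x (s - d) $ x s)" for x
  proof -
    have "cyl (insert s {s - d}) x = cyl {s - d} x * mat_power P d $ x (s - d) $ x s"
      using cyl_jump[of "{s - d}" "s - d" d x] assms by simp
    moreover have "cyl (insert (s + d) (insert s {s - d})) x
        = cyl (insert s {s - d}) x * mat_power P d $ x s $ x (s + d)"
      using assms by (intro cyl_jump) auto
    ultimately show ?thesis by (simp add: insert_commute)
  qed
  have ne: "s - d \<noteq> s" "s + d \<noteq> s" using assms by auto
  have "cyl {s - d, s + d} z = (\<Sum>u\<in>UNIV. cyl (insert s {s - d, s + d}) (z(s := u)))"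
    using assms by (intro cyl_marginal) auto
  also have "\<dots> = (\<Sum>u\<in>UNIV. cyl {s - d} z *
      (mat_power P d $ u $ z (s + d) * mat_power P d $ z (s - d) $ u))"
  proof (rule sum.cong[OF refl])
    fix u
    have "cyl {s - d} (z(s := u)) = cyl {s - d} z"
      using assms by (intro cyl_cong) auto
    then show "cyl (insert s {s - d, s + d}) (z(s := u)) = cyl {s - d} z *
        (mat_power P d $ u $ z (s + d) * mat_power P d $ z (s - d) $ u)"
      using three[of "z(s := u)"] ne by (simp add: insert_commute)
  qed
  finally have "cyl {s - d, s + d} z = cyl {s - d} z *
      (\<Sum>u\<in>UNIV. mat_power P d $ u $ z (s + d) * mat_power P d $ z (s - d) $ u)"
    by (simp add: sum_distrib_left)
  moreover have "cyl {s - d} z > 0" using assms by (intro cyl_pos) auto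
  ultimately show ?thesis by (simp add: three)
qed

end


section \<open>The dyadic sites\<close>

lemma gap_pos: "0 < gap r j"
  by (simp add: gap_def)

lemma gap_double:
  assumes "j \<in> {2..r + 1}"
  shows "gap r (j - 1) = 2 * gap r j"
proof -
  have "r + 1 - (j - 1) = Suc (r + 1 - j)" using assms by auto
  then show ?thesis by (simp add: gap_def)
qed

lemma gap_span:
  assumes "j \<in> {1..r + 1}"
  shows "2 ^ (j - 1) * gap r j = 2 ^ r"
  using assms by (auto simp: gap_def simp flip: power_add)

lemma power_halve:
  assumes "j \<in> {2..r + 1}"
  shows "2 ^ (j - 1) = 2 * (2::nat) ^ (j - 1 - 1)"
proof -
  have "j - 1 = Suc (j - 1 - 1)" using assms by auto
  then show ?thesis by (metis power_Suc)
qed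

lemma sites_iff: "s \<in> sites r j \<longleftrightarrow> (\<exists>k \<le> 2 ^ (j - 1). s = 1 + k * gap r j)"
  by (auto simp: sites_def)

lemma sites_subset:
  assumes "j \<in> {1..r + 1}"
  shows "sites r j \<subseteq> {1..2 ^ r + 1}"
proof
  fix s assume "s \<in> sites r j"
  then obtain k where "k \<le> 2 ^ (j - 1)" "s = 1 + k * gap r j" by (auto simp: sites_iff)
  then show "s \<in> {1..2 ^ r + 1}"
    using gap_span[OF assms] mult_le_mono1[of k "2 ^ (j - 1)" "gap r j"] by simp
qed

lemma sites_gap:
  assumes "s \<in> sites r j" "t \<in> sites r j" "s < t"
  shows "s + gap r j \<in> sites r j" "s + gap r j \<le> t"
proof -
  obtain k l where kl: "s = 1 + k * gap r j" "t = 1 + l * gap r j" "l \<le> 2 ^ (j - 1)"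
    using assms by (auto simp: sites_iff)
  then have "k < l" using assms(3) gap_pos[of r j] by simp
  then have "Suc k \<le> l" by simp
  then show "s + gap r j \<le> t"
    using mult_le_mono1[of "Suc k" l "gap r j"] kl by simp
  show "s + gap r j \<in> sites r j"
    unfolding sites_iff using kl \<open>Suc k \<le> l\<close> by (intro exI[of _ "Suc k"]) auto
qed

lemma consecutive_sites: "consecutive (sites r j) s t \<Longrightarrow> t = s + gap r j"
  using sites_gap[of s r j t] gap_pos[of r j]
  unfolding consecutive_def disjoint_iff greaterThanLessThan_iff
  by (metis less_add_same_cancel1 le_neq_implies_less)

lemma interior_site:
  assumes "j \<in> {1..r + 1}" "s \<in> sites r j - {1, 2 ^ r + 1}"
  shows "gap r j < s" "s - gap r j \<in> sites r j" "s + gap r j \<in> sites r j"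
proof -
  obtain k where k: "k \<le> 2 ^ (j - 1)" "s = 1 + k * gap r j"
    using assms by (auto simp: sites_iff)
  with assms have "k \<noteq> 0" by auto
  moreover have "k \<noteq> 2 ^ (j - 1)" using k assms gap_span[OF assms(1)] by auto
  ultimately obtain l where l: "k = Suc l" "Suc k \<le> 2 ^ (j - 1)"
    using k(1) by (metis not0_implies_Suc le_neq_implies_less Suc_leI)
  show "gap r j < s" using k l by simp
  show "s - gap r j \<in> sites r j"
    unfolding sites_iff using k l by (intro exI[of _ l]) auto
  show "s + gap r j \<in> sites r j"
    unfolding sites_iff using k l by (intro exI[of _ "Suc k"]) auto
qed

lemma sites_refine:
  assumes "j \<in> {2..r + 1}"
  shows "sites r (j - 1) \<subseteq> sites r j"
proof
  fix s assume "s \<in> sites r (j - 1)"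
  then obtain k where k: "k \<le> 2 ^ (j - 1 - 1)" "s = 1 + (2 * k) * gap r j"
    unfolding sites_iff gap_double[OF assms] by (auto simp: ac_simps)
  moreover have "2 ^ (j - 1) = 2 * (2::nat) ^ (j - 1 - 1)"
    by (rule power_halve[OF assms])
  ultimately show "s \<in> sites r j"
    unfolding sites_iff by (intro exI[of _ "2 * k"]) auto
qed

text \<open>A new site has an odd index in units of \<open>gap r j\<close>, so both of its neighbours have even
  indices.\<close>

lemma new_site:
  assumes j: "j \<in> {2..r + 1}" and s: "s \<in> sites r j - sites r (j - 1)"
  shows "gap r j < s" "s - gap r j \<in> sites r (j - 1)" "s + gap r j \<in> sites r (j - 1)"
proof -
  obtain k where k: "k \<le> 2 ^ (j - 1)" "s = 1 + k * gap r j"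
    using s by (auto simp: sites_iff)
  note two = power_halve[OF j]
  have "odd k"
  proof
    assume "even k"
    then obtain l where "k = 2 * l" by (elim evenE)
    then have "s \<in> sites r (j - 1)"
      using k two unfolding sites_iff gap_double[OF j] by (intro exI[of _ l]) auto
    then show False using s by simp
  qed
  then obtain l where l: "k = 2 * l + 1" by (elim oddE)
  show "gap r j < s" using k l by simp
  show "s - gap r j \<in> sites r (j - 1)"
    using k two l unfolding sites_iff gap_double[OF j] by (intro exI[of _ l]) auto
  show "s + gap r j \<in> sites r (j - 1)"
    using k two l unfolding sites_iff gap_double[OF j]
    by (intro exI[of _ "Suc l"]) (auto simp: algebra_simps)
qed

lemma site_isolated:
  assumes "s \<in> sites r j" "t \<in> sites r j" "s - gap r j < t" "t < s + gap r j"
  shows "t = s"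
proof (rule ccontr)
  assume "t \<noteq> s"
  then consider "s < t" | "t < s" by linarith
  then show False
    by cases (use sites_gap(2)[of s r j t] sites_gap(2)[of t r j s] assms in linarith)+
qed

context positive_chain
begin

text \<open>The new sites are inserted one at a time into the coarser set; since the two
  neighbours of each lie in the coarser set and nothing else lies between them, the factor does
  not depend on which new sites are already present.\<close>

lemma refine_sites:
  assumes T: "T = 2 ^ r + 1" and j: "j \<in> {2..r + 1}"
  shows "cyl (sites r j) z =
    (\<Prod>s\<in>sites r j - sites r (j - 1). bilateral_cond (law M Z (sites r j)) (gap r j) s z)
      * cyl (sites r (j - 1)) z"
proof -
  let ?d = "gap r j" and ?S = "sites r j" and ?S' = "sites r (j - 1)"
  let ?c = "\<lambda>s. bilateral_cond (law M Z ?S) ?d s z"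
  have sub: "?S \<subseteq> {1..T}" "?S' \<subseteq> ?S"
    using sites_subset[of j r] sites_refine[OF j] j T by auto
  have ins: "cyl (?S' \<union> D) z = prod ?c D * cyl ?S' z" if "finite D" "D \<subseteq> ?S - ?S'" for D
    using that
  proof (induction D)
    case empty
    show ?case by simp
  next
    case (insert s D)
    then have s: "s \<in> ?S - ?S'" by simp
    note nb = new_site[OF j s]
    have "cyl (insert s (?S' \<union> D)) z
        = cyl {s - ?d, s, s + ?d} z / cyl {s - ?d, s + ?d} z * cyl (?S' \<union> D) z"
    proof (rule cyl_insert_between)
      show "?S' \<union> D \<subseteq> {1..T}" using sub insert.prems by blast
      show "(?S' \<union> D) \<inter> {s - ?d<..<s + ?d} = {}"
      proof -
        have "t = s" if "t \<in> ?S' \<union> D" "s - ?d < t" "t < s + ?d" for t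
          using site_isolated[of s r j t] that s sub(2) insert.prems by blast
        then show ?thesis using s insert.hyps(2) by fastforce
      qed
    qed (use nb gap_pos[of r j] in auto)
    also have "cyl {s - ?d, s, s + ?d} z / cyl {s - ?d, s + ?d} z = ?c s"
      using sub nb s by (intro bilateral_cond_cyl[symmetric]) auto
    finally show ?case using insert by simp
  qed
  have "finite ?S" by (simp add: sites_def)
  moreover have "?S' \<union> (?S - ?S') = ?S" using sub by auto
  ultimately show ?thesis using ins[of "?S - ?S'"] by simp
qed

lemma telescope_sites:
  assumes T: "T = 2 ^ r + 1" and "j \<in> {1..r + 1}"
  shows "cyl (sites r j) z =
    (\<Prod>i\<in>{2..j}. \<Prod>s\<in>sites r i - sites r (i - 1).
      bilateral_cond (law M Z (sites r i)) (gap r i) s z) * cyl (sites r 1) z"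
  using assms(2)
proof (induction j)
  case (Suc j)
  show ?case
  proof (cases "j = 0")
    case False
    then have "{2..Suc j} = insert (Suc j) {2..j}" by auto
    then show ?thesis using refine_sites[OF T, of "Suc j" z] Suc False by simp
  qed simp
qed simp

end


section \<open>Gibbs distributions are positive chains\<close>

lemma gibbs_weight_Suc:
  "1 \<le> t \<Longrightarrow> gibbs_weight h (Suc t) z = gibbs_weight h t z * exp (h t (z t) (z (Suc t)))"
  by (cases t) (auto simp: gibbs_weight_def exp_add)

lemma gibbs_weight_Suc_upd:
  assumes "1 \<le> t"
  shows "gibbs_weight h (Suc t) (z(Suc t := w)) = gibbs_weight h t z * exp (h t (z t) w)"
proof -
  have "gibbs_weight h t (z(Suc t := w)) = gibbs_weight h t z"
    unfolding gibbs_weight_def by (intro arg_cong[where f = exp] sum.cong) auto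
  then show ?thesis using assms by (simp add: gibbs_weight_Suc)
qed

lemma gibbs_const_pos: "0 < gibbs_const h T"
  unfolding gibbs_const_def gibbs_weight_def
  by (intro sum_pos) (auto simp: finite_PiE PiE_eq_empty_iff)

context finite_process
begin

text \<open>Backward induction on \<open>t\<close>: the last coordinate occurs only in the last factor of the weight,
  so summing it out replaces \<open>b\<close> by its image under the positive transfer operator with kernel
  \<open>exp (h t v w)\<close>.\<close>

lemma gibbs_prefix:
  fixes h :: "nat \<Rightarrow> 'e \<Rightarrow> 'e \<Rightarrow> real"
  assumes full: "\<And>z. cyl {1..T} z = c * gibbs_weight h T z" and "0 < c"
    and "1 \<le> t" "t \<le> T"
  shows "\<exists>b. (\<forall>v. 0 < b v) \<and> (\<forall>z. cyl {1..t} z = gibbs_weight h t z * b (z t))"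
  using assms(4,3)
proof (induction t rule: inc_induct)
  case base
  show ?case using full assms(2) by (intro exI[of _ "\<lambda>_. c"]) simp
next
  case (step t)
  then obtain b where b: "\<forall>v. 0 < b v" "\<And>z. cyl {1..Suc t} z = gibbs_weight h (Suc t) z * b (z (Suc t))"
    by auto
  define b' where "b' v = (\<Sum>w\<in>UNIV. exp (h t v w) * b w)" for v
  have "cyl {1..t} z = gibbs_weight h t z * b' (z t)" for z
  proof -
    have "cyl {1..t} z = (\<Sum>w\<in>UNIV. cyl (insert (Suc t) {1..t}) (z(Suc t := w)))"
      using step by (intro cyl_marginal) auto
    also have "insert (Suc t) {1..t} = {1..Suc t}" by auto
    also have "(\<Sum>w\<in>UNIV. cyl {1..Suc t} (z(Suc t := w)))
        = (\<Sum>w\<in>UNIV. gibbs_weight h t z * (exp (h t (z t) w) * b w))"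
    proof (intro sum.cong refl)
      fix w
      show "cyl {1..Suc t} (z(Suc t := w)) = gibbs_weight h t z * (exp (h t (z t) w) * b w)"
        unfolding b(2) using gibbs_weight_Suc_upd[of t h z w] step.prems by simp
    qed
    also have "\<dots> = gibbs_weight h t z * b' (z t)"
      by (simp add: b'_def sum_distrib_left)
    finally show ?thesis .
  qed
  moreover have "0 < b' v" for v
    unfolding b'_def using b(1) by (intro sum_pos) auto
  ultimately show ?case by blast
qed

text \<open>The Gibbs form gives a transition kernel \<open>R\<close> that could a priori depend on \<open>t\<close>; conditioning on
  \<open>Z t\<close> alone, an event of positive probability for every value, identifies it with \<open>P\<close>.\<close>

lemma positive_chain_of_gibbs:
  fixes h :: "nat \<Rightarrow> 'e \<Rightarrow> 'e \<Rightarrow> real"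
  assumes full: "\<And>z. cyl {1..T} z = c * gibbs_weight h T z" and c: "0 < c"
    and T: "1 < T"
    and P: "\<And>t v w. t \<in> {1..T - 1} \<Longrightarrow> \<P>(\<omega> in M. Z (t + 1) \<omega> = w \<bar> Z t \<omega> = v) = P $ v $ w"
  shows "positive_chain M Z T P"
proof unfold_locales
  show "1 < T" by (rule T)
  show full_pos: "0 < cyl {1..T} z" for z
    using full[of z] c by (simp add: gibbs_weight_def)
  fix t z
  assume t: "1 \<le> t" "t < T"
  obtain b where b: "\<And>v. 0 < b v" "\<And>z. cyl {1..t} z = gibbs_weight h t z * b (z t)"
    using gibbs_prefix[OF full c, of t] t by auto
  obtain b' where b': "\<And>z. cyl {1..t + 1} z = gibbs_weight h (t + 1) z * b' (z (t + 1))"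
    using gibbs_prefix[OF full c, of "t + 1"] t by auto
  define R where "R v w = exp (h t v w) * b' w / b v" for v w
  have step: "cyl {1..t + 1} z = cyl {1..t} z * R (z t) (z (t + 1))" for z
    unfolding b b' R_def using b(1)[of "z t"] t by (simp add: gibbs_weight_Suc)
  have "P $ v $ w = R v w" for v w
  proof -
    let ?z = "(\<lambda>_. v)(t + 1 := w)"
    have "P $ v $ w = \<P>(\<omega> in M. Z (t + 1) \<omega> = w \<bar> Z t \<omega> = v)"
      by (rule P[symmetric]) (use t in auto)
    also have "\<dots> = cyl {t, t + 1} ?z / cyl {t} ?z"
      by (rule cond_prob_cyl) auto
    also have "cyl {t, t + 1} ?z = cyl {t} ?z * R v w"
      using step_forget_past[OF step, of "{t}" ?z] t by (simp add: insert_commute)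
    also have "\<dots> / cyl {t} ?z = R v w"
      using cyl_pos_of_full[OF full_pos, of "{t}" ?z] t by simp
    finally show ?thesis .
  qed
  then show "cyl {1..t + 1} z = cyl {1..t} z * P $ z t $ z (t + 1)"
    using step by simp
qed

end

theorem mainTheorem4:
  fixes M :: "'w measure"
    and Z :: "nat \<Rightarrow> 'w \<Rightarrow> 'e::finite"
    and h :: "nat \<Rightarrow> 'e \<Rightarrow> 'e \<Rightarrow> real"
    and P :: "real^'e^'e"
    and r T :: nat
  assumes r: "1 \<le> r"
    and T: "T = 2 ^ r + 1"
    and M: "prob_space M"
    and Z: "\<And>t. t \<in> {1..T} \<Longrightarrow> Z t \<in> measurable M (count_space UNIV)"
    and gibbs: "\<And>z. \<P>(x in law M Z {1..T}. \<forall>s\<in>{1..T}. x s = z s)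
                  = inverse (gibbs_const h T) * gibbs_weight h T z"
    and P: "\<And>t v w. t \<in> {1..T - 1} \<Longrightarrow>
              \<P>(\<omega> in M. Z (t + 1) \<omega> = w \<bar> Z t \<omega> = v) = P $ v $ w"
  shows
    "nn_markov_field M Z {1..T} \<and>
     markov_chain M Z {1..T} P \<and>
     (\<forall>t\<in>{2..T - 1}. \<forall>z.
        bilateral_cond (law M Z {1..T}) 1 t z =
          \<P>(x in law M Z {1..T}. x (t + 1) = z (t + 1) \<bar> x t = z t) *
          \<P>(x in law M Z {1..T}. x t = z t \<bar> x (t - 1) = z (t - 1)) /
          (\<Sum>u\<in>UNIV.
             \<P>(x in law M Z {1..T}. x (t + 1) = z (t + 1) \<bar> x t = u) *
             \<P>(x in law M Z {1..T}. x t = u \<bar> x (t - 1) = z (t - 1)))) \<and>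
     (\<forall>j\<in>{1..r + 1}. markov_chain M Z (sites r j) (mat_power P (gap r j))) \<and>
     (\<forall>j\<in>{2..r + 1}.
        nn_markov_field M Z (sites r j) \<and>
        (\<forall>s\<in>sites r j - {1, T}. \<forall>z.
           bilateral_cond (law M Z (sites r j)) (gap r j) s z =
             mat_power P (gap r j) $ z s $ z (s + gap r j) *
             mat_power P (gap r j) $ z (s - gap r j) $ z s /
             (\<Sum>u\<in>UNIV.
                mat_power P (gap r j) $ u $ z (s + gap r j) *
                mat_power P (gap r j) $ z (s - gap r j) $ u))) \<and>
     (\<forall>z. \<P>(x in law M Z {1..T}. \<forall>s\<in>{1..T}. x s = z s) =
        (\<Prod>j\<in>{2..r + 1}. \<Prod>s\<in>sites r j - sites r (j - 1).
           bilateral_cond (law M Z (sites r j)) (gap r j) s z) *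
        \<P>(x in law M Z (sites r 1). x 1 = z 1 \<and> x T = z T))"
proof -
  interpret finite_process M Z T
    using M Z by (simp add: finite_process_def finite_process_axioms_def)
  have T1: "1 < T" using T by simp
  have pi: "\<P>(x in law M Z {1..T}. \<forall>s\<in>{1..T}. x s = z s) = cyl {1..T} z" for z
    by (rule prob_law) auto
  interpret positive_chain M Z T P
  proof (rule positive_chain_of_gibbs[OF _ _ T1 P])
    show "cyl {1..T} z = inverse (gibbs_const h T) * gibbs_weight h T z" for z
      using gibbs[of z] pi[of z] by simp
    show "0 < inverse (gibbs_const h T)" by (simp add: gibbs_const_pos)
  qed
  have finest: "sites r (r + 1) = {1..T}" "gap r (r + 1) = 1"
    using sites_finest[of r] by (simp_all add: T gap_def)
  have sub: "sites r j \<subseteq> {1..T}" if "j \<in> {1..r + 1}" for j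
    using sites_subset[OF that] T by simp
  have chain: "markov_chain M Z (sites r j) (mat_power P (gap r j))" if "j \<in> {1..r + 1}" for j
    using chain_on_subset[OF sub[OF that]] consecutive_sites gap_pos by blast
  have trans: "\<P>(x in law M Z {1..T}. x (t + 1) = w \<bar> x t = v) = P $ v $ w"
    if t: "t \<in> {1..T - 1}" for t v w
  proof -
    let ?z = "(\<lambda>_. v)(t + 1 := w)"
    have "\<P>(x in law M Z {1..T}. x (t + 1) = w \<bar> x t = v) = cyl {t, t + 1} ?z / cyl {t} ?z"
      using t by (intro cond_prob_law) auto
    also have "\<dots> = \<P>(\<omega> in M. Z (t + 1) \<omega> = w \<bar> Z t \<omega> = v)"
      by (rule cond_prob_cyl[symmetric]) auto
    finally show ?thesis using P[OF t] by simp
  qed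
  show ?thesis
  proof (intro conjI ballI allI)
    show "nn_markov_field M Z {1..T}" by (rule field_on_subset) simp
    show "markov_chain M Z {1..T} P" using chain[of "r + 1"] finest by simp
  next
    fix t and z :: "nat \<Rightarrow> 'e"
    assume t: "t \<in> {2..T - 1}"
    have t': "t - 1 \<in> {1..T - 1}" "t - 1 + 1 = t" using t by auto
    have prev: "\<P>(x in law M Z {1..T}. x t = u \<bar> x (t - 1) = v) = P $ v $ u" for u v
      using trans[OF t'(1), of u v] unfolding t'(2) .
    have "bilateral_cond (law M Z {1..T}) 1 t z
        = cyl {t - 1, t, t + 1} z / cyl {t - 1, t + 1} z"
      using t by (intro bilateral_cond_cyl) auto
    also have "\<dots> = P $ z t $ z (t + 1) * P $ z (t - 1) $ z t
        / (\<Sum>u\<in>UNIV. P $ u $ z (t + 1) * P $ z (t - 1) $ u)"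
    proof -
      have "1 < t" "t + 1 \<le> T" using t by auto
      then show ?thesis using bilateral_link[of 1 t z] by simp
    qed
    also have "\<dots> =
          \<P>(x in law M Z {1..T}. x (t + 1) = z (t + 1) \<bar> x t = z t) *
          \<P>(x in law M Z {1..T}. x t = z t \<bar> x (t - 1) = z (t - 1)) /
          (\<Sum>u\<in>UNIV.
             \<P>(x in law M Z {1..T}. x (t + 1) = z (t + 1) \<bar> x t = u) *
             \<P>(x in law M Z {1..T}. x t = u \<bar> x (t - 1) = z (t - 1)))"
    proof -
      have "t \<in> {1..T - 1}" using t by auto
      then show ?thesis by (simp only: prev trans)
    qed
    finally show "bilateral_cond (law M Z {1..T}) 1 t z =
          \<P>(x in law M Z {1..T}. x (t + 1) = z (t + 1) \<bar> x t = z t) *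
          \<P>(x in law M Z {1..T}. x t = z t \<bar> x (t - 1) = z (t - 1)) /
          (\<Sum>u\<in>UNIV.
             \<P>(x in law M Z {1..T}. x (t + 1) = z (t + 1) \<bar> x t = u) *
             \<P>(x in law M Z {1..T}. x t = u \<bar> x (t - 1) = z (t - 1)))" .
  next
    fix j
    assume "j \<in> {1..r + 1}"
    then show "markov_chain M Z (sites r j) (mat_power P (gap r j))" by (rule chain)
  next
    fix j
    assume "j \<in> {2..r + 1}"
    then have j: "j \<in> {1..r + 1}" by simp
    show "nn_markov_field M Z (sites r j)" by (rule field_on_subset[OF sub[OF j]])
    fix s and z :: "nat \<Rightarrow> 'e"
    assume s: "s \<in> sites r j - {1, T}"
    note nb = interior_site[OF j s[unfolded T]]
    have "bilateral_cond (law M Z (sites r j)) (gap r j) s z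
        = cyl {s - gap r j, s, s + gap r j} z / cyl {s - gap r j, s + gap r j} z"
      using s nb by (intro bilateral_cond_cyl sub[OF j]) auto
    also have "\<dots> = mat_power P (gap r j) $ z s $ z (s + gap r j) *
             mat_power P (gap r j) $ z (s - gap r j) $ z s /
             (\<Sum>u\<in>UNIV.
                mat_power P (gap r j) $ u $ z (s + gap r j) *
                mat_power P (gap r j) $ z (s - gap r j) $ u)"
      using nb sub[OF j] gap_pos[of r j] by (intro bilateral_link) auto
    finally show "bilateral_cond (law M Z (sites r j)) (gap r j) s z =
             mat_power P (gap r j) $ z s $ z (s + gap r j) *
             mat_power P (gap r j) $ z (s - gap r j) $ z s /
             (\<Sum>u\<in>UNIV.
                mat_power P (gap r j) $ u $ z (s + gap r j) *
                mat_power P (gap r j) $ z (s - gap r j) $ u)" .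
  next
    fix z :: "nat \<Rightarrow> 'e"
    have "\<P>(x in law M Z (sites r 1). x 1 = z 1 \<and> x T = z T) = cyl (sites r 1) z"
    proof (rule prob_law)
      show "sites r 1 \<subseteq> {1..T}" by (rule sub) simp
      show "x 1 = z 1 \<and> x T = z T \<longleftrightarrow> (\<forall>u\<in>sites r 1. x u = z u)" for x
        unfolding sites_coarsest T by blast
    qed simp
    then show "\<P>(x in law M Z {1..T}. \<forall>s\<in>{1..T}. x s = z s) =
        (\<Prod>j\<in>{2..r + 1}. \<Prod>s\<in>sites r j - sites r (j - 1).
           bilateral_cond (law M Z (sites r j)) (gap r j) s z) *
        \<P>(x in law M Z (sites r 1). x 1 = z 1 \<and> x T = z T)"
      using telescope_sites[OF T, of "r + 1" z] pi[of z] finest(1) by simp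
  qed
qed

end
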